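(* Let $L, L_1 \in \mathbb{N}$ with $L \le L_1$, and let $P^{IP}_{L,L_1}$ be the tightened sawtooth relaxation of $z = x^2$, $x\in[0,1]$, with LP relaxation $P^{LP}_{L,L_1}$. Then $P^{IP}_{L,L_1}$ is hereditarily sharp, i.e. for every $I \subseteq \{1,\dots,L\}$ and every $\hat{\boldsymbol\alpha} \in \{0,1\}^{I}$, $$\operatorname{proj}_{x,z}\bigl(P^{LP}_{L,L_1}|_{\boldsymbol\alpha_I = \hat{\boldsymbol\alpha}}\bigr) = \operatorname{conv}\bigl(\operatorname{proj}_{x,z}(P^{IP}_{L,L_1}|_{\boldsymbol\alpha_I = \hat{\boldsymbol\alpha}})\bigr).$$
   Context: $\mathbb{N}=\{0,1,2,\dots\}$. For an integer $j\ge 0$ and a vector $\boldsymbol g=(g_0,g_1,\dots)$ with at least $j+1$ entries put $f^j(x,\boldsymbol g) = x - \sum_{i=1}^j 2^{-2i} g_i$. For $L,L_1\in\mathbb{N}$ with $L\le L_1$, the tightened sawtooth relaxation $P^{IP}_{L,L_1}$ is the set of all $(x,z,\boldsymbol g,\boldsymbol\alpha)\in[0,1]\times\mathbb{R}\times[0,1]^{L_1+1}\times\{0,1\}^L$, $\boldsymbol g=(g_0,\dots,g_{L_1})$, $\boldsymbol\alpha=(\alpha_1,\dots,\alpha_L)$, such that - $g_0=x$; - $2(g_{j-1}-\alpha_j)\le g_j\le 2g_{j-1}$ and $2(\alpha_j-g_{j-1})\le g_j\le 2(1-g_{j-1})$ for $j=1,\dots,L$; - $g_j\le 2g_{j-1}$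 and $g_j\le 2(1-g_{j-1})$ for $j=1,\dots,L_1$; - $z\le f^L(x,\boldsymbol g)$; - $z\ge f^j(x,\boldsymbol g)-2^{-2j-2}$ for $j=0,\dots,L_1$; $z\ge 0$; $z\ge 2x-1$. Its LP relaxation $P^{LP}_{L,L_1}$ is obtained by replacing $\boldsymbol\alpha\in\{0,1\}^L$ by $\boldsymbol\alpha\in[0,1]^L$. $\operatorname{proj}_{x,z}$ denotes projection onto the $(x,z)$-coordinates, $\boldsymbol\alpha_I=(\alpha_i)_{i\in I}$, and $P|_{\boldsymbol\alpha_I=\hat{\boldsymbol\alpha}}$ is the set of points of $P$ satisfying $\boldsymbol\alpha_I=\hat{\boldsymbol\alpha}$. *)

theory Defs
  imports "HOL-Analysis.Analysis"
begin

definition saw :: "nat \<Rightarrow> real \<Rightarrow> (nat \<Rightarrow> real) \<Rightarrow> real" where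
  "saw j x g = x - (\<Sum>i=1..j. g i / 2 ^ (2 * i))"

text \<open>
  The vectors \<open>(g\<^sub>0, \<dots>, g\<^sub>L\<^sub>1)\<close> and \<open>(\<alpha>\<^sub>1, \<dots>, \<alpha>\<^sub>L)\<close> are extensional functions on
  \<open>{0..L1}\<close> and \<open>{1..L}\<close>, so tuples and functions correspond one to one.
  The set \<open>A\<close> is the domain of each \<open>\<alpha>\<^sub>j\<close>.
\<close>

type_synonym point = "real \<times> real \<times> (nat \<Rightarrow> real) \<times> (nat \<Rightarrow> real)"

definition tightened_sawtooth :: "real set \<Rightarrow> nat \<Rightarrow> nat \<Rightarrow> point set" where
  "tightened_sawtooth A L L1 =
    {(x, z, g, \<alpha>).
      x \<in> {0..1} \<and> g \<in> {0..L1} \<rightarrow>\<^sub>E {0..1} \<and> \<alpha> \<in> {1..L} \<rightarrow>\<^sub>E A \<and>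
      g 0 = x \<and>
      (\<forall>j\<in>{1..L}.
         2 * (g (j - 1) - \<alpha> j) \<le> g j \<and> g j \<le> 2 * g (j - 1) \<and>
         2 * (\<alpha> j - g (j - 1)) \<le> g j \<and> g j \<le> 2 * (1 - g (j - 1))) \<and>
      (\<forall>j\<in>{1..L1}. g j \<le> 2 * g (j - 1) \<and> g j \<le> 2 * (1 - g (j - 1))) \<and>
      z \<le> saw L x g \<and>
      (\<forall>j\<in>{0..L1}. z \<ge> saw j x g - 1 / 2 ^ (2 * j + 2)) \<and>
      z \<ge> 0 \<and> z \<ge> 2 * x - 1}"

definition P_IP :: "nat \<Rightarrow> nat \<Rightarrow> point set" where
  "P_IP L L1 = tightened_sawtooth {0, 1} L L1"

definition P_LP :: "nat \<Rightarrow> nat \<Rightarrow> point set" where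
  "P_LP L L1 = tightened_sawtooth {0..1} L L1"

definition fix_alpha :: "nat set \<Rightarrow> (nat \<Rightarrow> real) \<Rightarrow> point set \<Rightarrow> point set" where
  "fix_alpha I a P = {(x, z, g, \<alpha>) \<in> P. \<forall>i\<in>I. \<alpha> i = a i}"

definition proj_xz :: "point set \<Rightarrow> (real \<times> real) set" where
  "proj_xz P = (\<lambda>(x, z, g, \<alpha>). (x, z)) ` P"

definition hereditarily_sharp :: "nat \<Rightarrow> point set \<Rightarrow> point set \<Rightarrow> bool" where
  "hereditarily_sharp L IP LP \<longleftrightarrow>
    (\<forall>I \<subseteq> {1..L}. \<forall>a \<in> I \<rightarrow>\<^sub>E {0, 1}.
       proj_xz (fix_alpha I a LP) = convex hull (proj_xz (fix_alpha I a IP)))"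

end

theory Submission
  imports Defs
begin

text \<open>
  Substituting \<open>z = x - y / 2 + z' / 4\<close> with \<open>y = g\<^sub>1\<close> turns the constraints on
  \<open>(g\<^sub>1, g\<^sub>2, \<dots>)\<close> into those of the relaxation of depth one less for \<open>(y, z')\<close>, so one argues by
  induction on \<open>L\<close>. Fixing \<open>\<alpha>\<^sub>1 = 0\<close> or \<open>\<alpha>\<^sub>1 = 1\<close> makes \<open>(x, z)\<close> an affine image of \<open>(y, z')\<close>; if \<open>\<alpha>\<^sub>1\<close> is
  free, \<open>(x, z)\<close> lies on the segment between these two images. The only obstacle is that the bound
  \<open>z' \<ge> 0\<close> is not implied by \<open>z \<ge> 0\<close> when \<open>\<alpha>\<^sub>1\<close> is free. If \<open>z' < 0\<close>, one slides \<open>(y, z')\<close> along a line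
  of slope 2, which leaves \<open>(x, z)\<close> unchanged, up to \<open>(h, 0)\<close>: the lower boundary has slope at most
  2, and it is nonnegative at the right end of the feasible interval, so \<open>(h, 0)\<close> is still feasible.
\<close>

section \<open>The relaxation as a recursion on levels\<close>

definition branch :: "bool option \<Rightarrow> real \<Rightarrow> real \<Rightarrow> bool" where
  "branch t x y \<longleftrightarrow> y \<le> 2 * x \<and> y \<le> 2 * (1 - x) \<and>
     (t = Some False \<longrightarrow> y = 2 * x) \<and> (t = Some True \<longrightarrow> y = 2 * (1 - x))"

text \<open>
  A list of type \<open>bool option list\<close> records \<open>\<alpha>\<^sub>1, \<alpha>\<^sub>2, \<dots>\<close>, with \<open>None\<close> for a free (or absent)
  variable: a free \<open>\<alpha>\<^sub>j\<close> imposes nothing on \<open>g\<close>, as the choice \<open>\<alpha>\<^sub>j = g\<^sub>j\<^sub>-\<^sub>1\<close> shows.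
\<close>

fun tower :: "(real \<Rightarrow> real \<Rightarrow> bool) \<Rightarrow> bool option list \<Rightarrow> real \<Rightarrow> real \<Rightarrow> bool" where
  "tower B [] x z = B x z"
| "tower B (t # s) x z =
     (\<exists>y z'. tower B s y z' \<and> branch t x y \<and> z = x - y / 2 + z' / 4 \<and> 2 * x - 1 \<le> z)"

text \<open>What is left at the last level: the cut for j = 0 and the bound
  \<open>2 * x - 1 \<le> z\<close>. The bound \<open>0 \<le> z\<close> is absent because it does not
  pass from z to z'; it is imposed only at the outermost level.\<close>

definition low_base :: "real \<Rightarrow> real \<Rightarrow> bool" where
  "low_base x z \<longleftrightarrow> 0 \<le> x \<and> x \<le> 1 \<and> 2 * x - 1 \<le> z \<and> x - 1 / 4 \<le> z"

abbreviation low :: "bool option list \<Rightarrow> real \<Rightarrow> real \<Rightarrow> bool" where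
  "low \<equiv> tower low_base"

text \<open>After L unfoldings the upper bound \<open>z \<le> f\<^sup>L(x, g)\<close> has turned
  into \<open>z \<le> x\<close>, and n = L1 - L levels of lower cuts remain.\<close>

definition capped :: "nat \<Rightarrow> real \<Rightarrow> real \<Rightarrow> bool" where
  "capped n x z \<longleftrightarrow> low (replicate n None) x z \<and> z \<le> x"

text \<open>Endpoints of the interval of those x for which \<open>low u x z\<close> holds for some
  z.\<close>

fun lo hi :: "bool option list \<Rightarrow> real" where
  "lo [] = 0"
| "lo (t # s) = (if t = Some True then 1 - hi s / 2 else lo s / 2)"
| "hi [] = 1"
| "hi (t # s) = (if t = Some False then hi s / 2 else 1 - lo s / 2)"

text \<open>The last conjunct keeps the right end away from 0: \<open>hi\<close> at most halves per
  level. It later gives nonnegativity of z at that end.\<close>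

lemma lo_hi_bounds: "0 \<le> lo u \<and> lo u \<le> hi u \<and> hi u \<le> 1 \<and> (1 / 2) ^ length u \<le> hi u"
proof (induction u)
  case (Cons t u)
  have "(1 / 2) ^ length u \<le> (1::real)"
    by (simp add: power_le_one)
  with Cons show ?case
    by auto
qed auto

lemma tower_append: "tower B (s @ u) = tower (tower B u) s"
proof (induction s)
  case (Cons t s)
  then show ?case
    by (intro ext) simp
qed auto

lemma tower_mono:
  assumes "tower B s x z" "\<And>x z. B x z \<Longrightarrow> C x z"
  shows "tower C s x z"
  using assms(1)
proof (induction s arbitrary: x z)
  case (Cons t s)
  then obtain y z' where "tower B s y z'" "branch t x y" "z = x - y / 2 + z' / 4" "2 * x - 1 \<le> z"
    by auto
  with Cons.IH show ?case
    by auto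
qed (simp add: assms(2))

lemma tower_ConsI:
  assumes "tower B s y (4 * (z - x + y / 2))" "branch t x y" "2 * x - 1 \<le> z"
  shows "tower B (t # s) x z"
  unfolding tower.simps
  by (rule exI[of _ y], rule exI[of _ "4 * (z - x + y / 2)"]) (use assms in \<open>simp add: field_simps\<close>)

section \<open>Shape of the lower boundary\<close>

lemma low_bounds: "low u x z \<Longrightarrow> lo u \<le> x \<and> x \<le> hi u"
proof (induction u arbitrary: x z)
  case Nil
  then show ?case
    by (simp add: low_base_def)
next
  case (Cons t u)
  then obtain y z' where "low u y z'" "branch t x y"
    by auto
  with Cons.IH[of y z'] show ?case
    by (auto simp: branch_def)
qed

lemma low_up: "low u x z \<Longrightarrow> z \<le> w \<Longrightarrow> low u x w"
proof (induction u arbitrary: x z w)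
  case Nil
  then show ?case
    by (simp add: low_base_def)
next
  case (Cons t u)
  then obtain y z' where "low u y z'" "branch t x y" "z = x - y / 2 + z' / 4" "2 * x - 1 \<le> z"
    by auto
  with Cons.IH[of y z' "4 * (w - x + y / 2)"] Cons.prems(2) show ?case
    by (intro tower_ConsI) auto
qed

text \<open>The slopes of the lower boundary of \<open>low u\<close> lie between 0 and 2.\<close>

lemma low_left_right:
  "(low u x z \<longrightarrow> lo u \<le> x' \<longrightarrow> x' \<le> x \<longrightarrow> low u x' z) \<and>
   (low u x z \<longrightarrow> x \<le> x' \<longrightarrow> x' \<le> hi u \<longrightarrow> low u x' (z + 2 * (x' - x)))"
proof (induction u arbitrary: x z x')
  case Nil
  then show ?case
    by (auto simp: low_base_def)
next
  case (Cons t u)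
  have left: "low u y' w" if "low u y z" "z \<le> w" "lo u \<le> y'" "y' \<le> y" for y z y' w
    using that Cons.IH[of y z y'] low_up by blast
  have right: "low u y' w" if "low u y z" "z + 2 * (y' - y) \<le> w" "y \<le> y'" "y' \<le> hi u" for y z y' w
    using that Cons.IH[of y z y'] low_up by blast
  show ?case
  proof (intro conjI impI)
    assume "low (t # u) x z" and x': "lo (t # u) \<le> x'" "x' \<le> x"
    then obtain y z' where *: "low u y z'" "branch t x y" "z = x - y / 2 + z' / 4" "2 * x - 1 \<le> z"
      by auto
    note b = *[unfolded branch_def] x' lo_hi_bounds[of u]
    have step: "low (t # u) x' z" if "low u y' (4 * (z - x' + y' / 2))" "branch t x' y'" for y'
      using tower_ConsI[OF that] * x' by simp
    \<comment> \<open>On the right branch y moves right when x moves left, which is why both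
      directions share one induction; z' then rises by \<open>8 * (x - x')\<close>, twice what slope
      2 demands. A free variable keeps y as long as \<open>y \<le> 2 * x'\<close>; otherwise y drops
      to \<open>2 * x'\<close>.\<close>
    consider "t = Some True" | "t = None" "y \<le> 2 * x'" | "t \<noteq> Some True" "2 * x' \<le> y"
      using b by (cases t; cases "y \<le> 2 * x'") auto
    then show "low (t # u) x' z"
    proof cases
      case 1
      show ?thesis
        by (rule step[of "2 * (1 - x')"], rule right[OF *(1)]) (use b 1 in \<open>auto simp: branch_def\<close>)
    next
      case 2
      show ?thesis
        by (rule step[of y], rule low_up[OF *(1)]) (use b 2 in \<open>auto simp: branch_def\<close>)
    next
      case 3
      show ?thesis
        by (rule step[of "2 * x'"], rule left[OF *(1)]) (use b 3 in \<open>auto simp: branch_def\<close>)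
    qed
  next
    assume "low (t # u) x z" and x': "x \<le> x'" "x' \<le> hi (t # u)"
    then obtain y z' where *: "low u y z'" "branch t x y" "z = x - y / 2 + z' / 4" "2 * x - 1 \<le> z"
      by auto
    note b = *[unfolded branch_def] x' lo_hi_bounds[of u]
    define w where "w = z + 2 * (x' - x)"
    have step: "low (t # u) x' w" if "low u y' (4 * (w - x' + y' / 2))" "branch t x' y'" for y'
      using tower_ConsI[OF that] * x' by (simp add: w_def)
    \<comment> \<open>The mirror image. When y drops to \<open>2 * (1 - x')\<close>, the increase of
      z by \<open>2 * (x' - x)\<close> exactly offsets the slope 2 of the right branch.\<close>
    consider "t = Some False" | "t = None" "y \<le> 2 * (1 - x')" | "t \<noteq> Some False" "2 * (1 - x') \<le> y"
      using b by (cases t; cases "y \<le> 2 * (1 - x')") auto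
    then have "low (t # u) x' w"
    proof cases
      case 1
      show ?thesis
        by (rule step[of "2 * x'"], rule right[OF *(1)]) (use b 1 in \<open>auto simp: w_def branch_def field_simps\<close>)
    next
      case 2
      show ?thesis
        by (rule step[of y], rule low_up[OF *(1)]) (use b 2 in \<open>auto simp: w_def branch_def field_simps\<close>)
    next
      case 3
      show ?thesis
        by (rule step[of "2 * (1 - x')"], rule left[OF *(1)]) (use b 3 in \<open>auto simp: w_def branch_def field_simps\<close>)
    qed
    then show "low (t # u) x' (z + 2 * (x' - x))"
      by (simp add: w_def)
  qed
qed

text \<open>With c = 2^(-length u), the bound is the tangent of x^2 at c / 2. Inserting the bound
  for z' into \<open>x - y / 2 + z' / 4\<close> gives an expression decreasing in y, so the worst
  case is y = 2 x, which halves c.\<close>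

lemma low_lower_bound: "low u x z \<Longrightarrow> (1 / 2) ^ length u * (x - (1 / 2) ^ length u / 4) \<le> z"
proof (induction u arbitrary: x z)
  case Nil
  then show ?case
    by (simp add: low_base_def)
next
  case (Cons t u)
  then obtain y z' where *: "low u y z'" "branch t x y" "z = x - y / 2 + z' / 4"
    by auto
  define c :: real where "c = (1 / 2) ^ length u"
  have c: "0 \<le> c" "c \<le> 1"
    by (auto simp: c_def power_le_one)
  have "c * (y - c / 4) \<le> z'"
    using Cons.IH[OF *(1)] by (simp add: c_def)
  moreover have "(1 - c / 2) * y \<le> (1 - c / 2) * (2 * x)"
    using c *(2) by (intro mult_left_mono) (auto simp: branch_def)
  ultimately have "c / 2 * (x - c / 8) \<le> z"
    using *(3) by (simp add: algebra_simps)
  then show ?case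
    by (simp add: c_def)
qed

text \<open>The tangent is nonnegative from c / 4 on, and \<open>hi u\<close> is at least c.\<close>

lemma low_hi_nonneg:
  assumes "low u (hi u) z"
  shows "0 \<le> z"
proof -
  have "(1 / 2) ^ length u / 4 \<le> ((1 / 2) ^ length u :: real)"
    by simp
  then have "0 \<le> (1 / 2) ^ length u * (hi u - (1 / 2) ^ length u / 4)"
    using lo_hi_bounds[of u] by (intro mult_nonneg_nonneg) auto
  with low_lower_bound[OF assms] show ?thesis
    by linarith
qed

text \<open>Below \<open>z = 0\<close> the bound \<open>z \<le> f\<^sup>L(x, g)\<close> is automatic.\<close>

lemma tower_capped_nonpos:
  assumes "low (s @ replicate n None) x z" "z \<le> 0"
  shows "tower (capped n) s x z"
  using assms
proof (induction s arbitrary: x z)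
  case Nil
  then show ?case
    using low_bounds[of "replicate n None" x z] lo_hi_bounds[of "replicate n None"]
    by (auto simp: capped_def)
next
  case (Cons t s)
  then obtain y z' where *: "low (s @ replicate n None) y z'" "branch t x y"
      "z = x - y / 2 + z' / 4" "2 * x - 1 \<le> z"
    by auto
  \<comment> \<open>\<open>x - y / 2\<close> is nonnegative, so the sign of z passes down to z'; at
    the bottom, \<open>z \<le> 0 \<le> x\<close> is the cap.\<close>
  then have "z' \<le> 0"
    using Cons.prems(2) by (auto simp: branch_def)
  with Cons.IH * show ?case
    by auto
qed

lemma low_of_tower_capped:
  "tower (capped n) s x z \<Longrightarrow> low (s @ replicate n None) x z"
  using tower_mono[of "capped n" s x z "low (replicate n None)"]
  by (simp add: tower_append capped_def)

section \<open>Convexity\<close>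

lemma convex_tower:
  assumes "convex {(x, z). B x z}"
  shows "convex {(x, z). tower B s x z}"
proof (induction s)
  case Nil
  then show ?case
    using assms by simp
next
  case (Cons t s)
  show ?case
  proof (rule convexI)
    fix p q and u v :: real
    assume uv: "0 \<le> u" "0 \<le> v" "u + v = 1"
      and "p \<in> {(x, z). tower B (t # s) x z}" "q \<in> {(x, z). tower B (t # s) x z}"
    then obtain x1 y1 z1 w1 x2 y2 z2 w2 where pq: "p = (x1, z1)" "q = (x2, z2)"
      and 1: "tower B s y1 w1" "branch t x1 y1" "z1 = x1 - y1 / 2 + w1 / 4" "2 * x1 - 1 \<le> z1"
      and 2: "tower B s y2 w2" "branch t x2 y2" "z2 = x2 - y2 / 2 + w2 / 4" "2 * x2 - 1 \<le> z2"
      by fastforce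
    have v: "v = 1 - u"
      using uv by simp
    have mono: "u * a + v * b \<le> u * c + v * d" if "a \<le> c" "b \<le> d" for a b c d
      using that uv by (intro add_mono mult_left_mono) auto
    \<comment> \<open>z' depends linearly on (x, y, z), so combining the witnesses y1 and y2
      combines w1 and w2 with the same weights.\<close>
    have "4 * ((u * z1 + v * z2) - (u * x1 + v * x2) + (u * y1 + v * y2) / 2) = u * w1 + v * w2"
      by (simp add: 1(3) 2(3) algebra_simps)
    then have "tower B s (u * y1 + v * y2)
        (4 * ((u * z1 + v * z2) - (u * x1 + v * x2) + (u * y1 + v * y2) / 2))"
      using convexD[OF Cons.IH, of "(y1, w1)" "(y2, w2)" u v] uv 1(1) 2(1) by simp
    moreover have "branch t (u * x1 + v * x2) (u * y1 + v * y2)"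
      unfolding branch_def
    proof (intro conjI impI)
      show "u * y1 + v * y2 \<le> 2 * (u * x1 + v * x2)"
        using mono[of y1 "2 * x1" y2 "2 * x2"] 1(2) 2(2) by (simp add: branch_def algebra_simps)
      show "u * y1 + v * y2 \<le> 2 * (1 - (u * x1 + v * x2))"
        using mono[of y1 "2 * (1 - x1)" y2 "2 * (1 - x2)"] 1(2) 2(2)
        by (simp add: branch_def v algebra_simps)
    next
      assume "t = Some False"
      then have "y1 = 2 * x1" "y2 = 2 * x2"
        using 1(2) 2(2) by (auto simp: branch_def)
      then show "u * y1 + v * y2 = 2 * (u * x1 + v * x2)"
        by (simp add: algebra_simps)
    next
      assume "t = Some True"
      then have "y1 = 2 * (1 - x1)" "y2 = 2 * (1 - x2)"
        using 1(2) 2(2) by (auto simp: branch_def)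
      then show "u * y1 + v * y2 = 2 * (1 - (u * x1 + v * x2))"
        by (simp only: v) (simp add: algebra_simps)
    qed
    moreover have "2 * (u * x1 + v * x2) - 1 \<le> u * z1 + v * z2"
      using mono[OF 1(4) 2(4)] by (simp add: v algebra_simps)
    ultimately have "tower B (t # s) (u * x1 + v * x2) (u * z1 + v * z2)"
      by (rule tower_ConsI)
    then show "u *\<^sub>R p + v *\<^sub>R q \<in> {(x, z). tower B (t # s) x z}"
      by (simp add: pq)
  qed
qed

lemma convex_low_base: "convex {(x, z). low_base x z}"
proof -
  have "{(x, z). low_base x z} =
      {p. inner (-1, 0) p \<le> 0} \<inter> {p. inner (1, 0) p \<le> 1} \<inter>
      {p. inner (2, -1) p \<le> 1} \<inter> {p. inner (1, -1) p \<le> 1 / 4}"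
    by (auto simp: low_base_def)
  then show ?thesis
    by (simp only: convex_Int convex_halfspace_le)
qed

lemma convex_tower_capped: "convex {(x, z). tower (capped n) s x z \<and> 0 \<le> z}"
proof -
  have "{(x, z). capped n x z} =
      {(x, z). low (replicate n None) x z} \<inter> {p. inner (-1, 1) p \<le> 0}"
    by (auto simp: capped_def)
  then have "convex {(x, z). capped n x z}"
    by (auto intro!: convex_Int convex_halfspace_le convex_tower convex_low_base)
  moreover have "{(x, z). tower (capped n) s x z \<and> 0 \<le> z} =
      {(x, z). tower (capped n) s x z} \<inter> {p. inner (0, -1) p \<le> 0}"
    by auto
  ultimately show ?thesis
    by (auto intro!: convex_Int convex_halfspace_le convex_tower)
qed

section \<open>Hull of the points with every binary variable decided\<close>

definition ip_region :: "bool option list \<Rightarrow> nat \<Rightarrow> (real \<times> real) set" where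
  "ip_region s n = {(x, z). 0 \<le> z \<and>
     (\<exists>bs. list_all2 (\<lambda>b t. t = None \<or> t = Some b) bs s \<and> tower (capped n) (map Some bs) x z)}"

text \<open>The two inverse branches of the tent map, x = y / 2 and x = 1 - y / 2, with z obtained
  from \<open>z = x - y / 2 + w / 4\<close>.\<close>

fun unfold_branch :: "bool \<Rightarrow> real \<times> real \<Rightarrow> real \<times> real" where
  "unfold_branch False (y, w) = (y / 2, w / 4)"
| "unfold_branch True (y, w) = (1 - y / 2, 1 - y + w / 4)"

lemma unfold_branch_ip_region:
  assumes "p \<in> ip_region s n" "t = None \<or> t = Some b"
  shows "unfold_branch b p \<in> ip_region (t # s) n"
proof -
  obtain y w bs where p: "p = (y, w)" "0 \<le> w" "list_all2 (\<lambda>b t. t = None \<or> t = Some b) bs s"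
      "tower (capped n) (map Some bs) y w"
    using assms(1) by (auto simp: ip_region_def)
  have y: "0 \<le> y" "y \<le> 1"
    using low_bounds[OF low_of_tower_capped[OF p(4)]] lo_hi_bounds[of "map Some bs @ replicate n None"]
    by auto
  obtain x z where xz: "unfold_branch b p = (x, z)"
    by fastforce
  have "branch (Some b) x y \<and> z = x - y / 2 + w / 4 \<and> 2 * x - 1 \<le> z \<and> 0 \<le> z"
    using xz p(1,2) y by (cases b) (auto simp: branch_def)
  then have "tower (capped n) (map Some (b # bs)) x z" "0 \<le> z"
    using p(4) by auto
  moreover have "list_all2 (\<lambda>b t. t = None \<or> t = Some b) (b # bs) (t # s)"
    using p(3) assms(2) by simp
  ultimately show ?thesis
    unfolding xz ip_region_def by blast
qed

lemma unfold_branch_affine: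
  assumes "u + v = 1"
  shows "unfold_branch b (u *\<^sub>R p + v *\<^sub>R q) = u *\<^sub>R unfold_branch b p + v *\<^sub>R unfold_branch b q"
proof -
  have "v = 1 - u"
    using assms by simp
  then show ?thesis
    by (cases b; cases p; cases q) (auto simp: field_simps)
qed

text \<open>The preimage of a convex set under an affine map is convex, so points of
  \<open>ip_region\<close> suffice.\<close>

lemma unfold_branch_hull:
  assumes "p \<in> convex hull (ip_region s n)" "t = None \<or> t = Some b"
  shows "unfold_branch b p \<in> convex hull (ip_region (t # s) n)"
proof -
  have "convex {p. unfold_branch b p \<in> convex hull (ip_region (t # s) n)}"
    by (rule convexI) (simp add: unfold_branch_affine convexD)
  moreover have "ip_region s n \<subseteq> {p. unfold_branch b p \<in> convex hull (ip_region (t # s) n)}"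
    using unfold_branch_ip_region[OF _ assms(2)] by (auto intro: hull_inc)
  ultimately show ?thesis
    using hull_minimal[of "ip_region s n"] assms(1) by blast
qed

text \<open>For fixed (y, w) the point moves along a line of slope 1 as x varies; the two images are
  its positions at the extreme values y / 2 and 1 - y / 2.\<close>

lemma unfold_branch_segment:
  assumes "y \<le> 2 * x" "y \<le> 2 * (1 - x)"
  shows "(x, x - y / 2 + w / 4) \<in> closed_segment (unfold_branch False (y, w)) (unfold_branch True (y, w))"
proof (cases "y = 1")
  case True
  then have "x = 1 / 2"
    using assms by simp
  with True show ?thesis
    by simp
next
  case False
  then have y: "y < 1"
    using assms by simp
  \<comment> \<open>The fraction of the segment's horizontal extent 1 - y lying left of x. At y = 1
    the endpoints coincide.\<close>
  define u where "u = (x - y / 2) / (1 - y)"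
  have "x = u * (1 - y) + y / 2"
    using y by (simp add: u_def)
  then have "(x, x - y / 2 + w / 4) =
      (1 - u) *\<^sub>R unfold_branch False (y, w) + u *\<^sub>R unfold_branch True (y, w)"
    by (simp add: field_simps)
  moreover have "0 \<le> u" "u \<le> 1"
    using y assms by (auto simp: u_def field_simps)
  ultimately show ?thesis
    by (auto simp: closed_segment_def)
qed

lemma tower_in_hull:
  assumes "tower (capped n) s x z" "0 \<le> z"
  shows "(x, z) \<in> convex hull (ip_region s n)"
  using assms
proof (induction s arbitrary: x z)
  case Nil
  then show ?case
    by (auto simp: ip_region_def intro!: hull_inc)
next
  case (Cons t s)
  then obtain y z' where *: "tower (capped n) s y z'" "branch t x y"
      "z = x - y / 2 + z' / 4" "2 * x - 1 \<le> z"
    by auto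
  show ?case
  proof (cases t)
    case (Some b)
    \<comment> \<open>z is z' / 4 on the left branch and 2 x - 1 + z' / 4 on the right one, so the
      two lower bounds on z yield \<open>0 \<le> z'\<close>.\<close>
    have "0 \<le> z' \<and> (x, z) = unfold_branch b (y, z')"
      using * Cons.prems(2) Some by (cases b) (auto simp: branch_def field_simps)
    then show ?thesis
      using unfold_branch_hull[OF Cons.IH[OF *(1)], of t b] Some by simp
  next
    case None
    \<comment> \<open>Stated for an arbitrary pair (h, w), since a negative z' forces a different
      pair than (y, z').\<close>
    have mem: "(x, x - h / 2 + w / 4) \<in> convex hull (ip_region (t # s) n)"
      if "tower (capped n) s h w" "0 \<le> w" "h \<le> 2 * x" "h \<le> 2 * (1 - x)" for h w
    proof -
      have "unfold_branch b (h, w) \<in> convex hull (ip_region (t # s) n)" for b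
        using unfold_branch_hull[OF Cons.IH[OF that(1,2)]] None by simp
      then show ?thesis
        using closed_segment_subset_convex_hull unfold_branch_segment[OF that(3,4)] by blast
    qed
    show ?thesis
    proof (cases "0 \<le> z'")
      case True
      then show ?thesis
        using mem[OF *(1)] * by (simp add: branch_def)
    next
      case False
      define u where "u = s @ replicate n None"
      \<comment> \<open>The zero of the line of slope 2 through (y, z').\<close>
      define h where "h = y - z' / 2"
      have lowy: "low u y z'"
        using low_of_tower_capped[OF *(1)] by (simp add: u_def)
      have "h \<le> hi u"
      proof (rule ccontr)
        assume "\<not> h \<le> hi u"
        \<comment> \<open>If the zero lay beyond \<open>hi u\<close>, the line would still be
          negative at \<open>hi u\<close>, where feasible values are nonnegative.\<close>
        then have "z' + 2 * (hi u - y) < 0"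
          by (simp add: h_def)
        moreover have "low u (hi u) (z' + 2 * (hi u - y))"
          using low_left_right[of u y z' "hi u"] lowy low_bounds[OF lowy] by blast
        ultimately show False
          using low_hi_nonneg by fastforce
      qed
      then have "low u h (z' + 2 * (h - y))"
        using low_left_right[of u y z' h] lowy False by (simp add: h_def)
      then have "low u h 0"
        by (simp add: h_def)
      then have "tower (capped n) s h 0"
        using tower_capped_nonpos by (simp add: u_def)
      \<comment> \<open>Since h = 2 (x - z), the bounds \<open>0 \<le> z\<close> and
        \<open>2 * x - 1 \<le> z\<close> say precisely that \<open>h \<le> 2 * x\<close> and
        \<open>h \<le> 2 * (1 - x)\<close>.\<close>
      then have "(x, x - h / 2 + 0 / 4) \<in> convex hull (ip_region (t # s) n)"
        using * Cons.prems(2) by (intro mem) (auto simp: h_def)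
      moreover have "x - h / 2 + 0 / 4 = z"
        using * by (simp add: h_def field_simps)
      ultimately show ?thesis
        by simp
    qed
  qed
qed

section \<open>From the recursion to sawtooth vectors\<close>

lemma all_le_Suc_conv: "(\<forall>j\<le>Suc n. P j) \<longleftrightarrow> P 0 \<and> (\<forall>j\<le>n. P (Suc j))"
  using All_less_Suc2[of "Suc n" P] by (simp add: less_Suc_eq_le)

definition saw_path :: "bool option list \<Rightarrow> (nat \<Rightarrow> real) \<Rightarrow> real \<Rightarrow> bool" where
  "saw_path u g z \<longleftrightarrow>
     (\<forall>j\<le>length u. 0 \<le> g j \<and> g j \<le> 1 \<and> saw j (g 0) g - 1 / 2 ^ (2 * j + 2) \<le> z) \<and>
     (\<forall>j<length u. branch (u ! j) (g j) (g (Suc j))) \<and> 2 * g 0 - 1 \<le> z"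

lemma saw_Suc:
  "saw (Suc j) (g 0) g = g 0 - g 1 / 2 + saw j (g 1) (\<lambda>i. g (Suc i)) / 4"
proof -
  have shift: "(\<Sum>i=1..Suc k. f i) = f 1 + (\<Sum>i=1..k. f (Suc i))" for k and f :: "nat \<Rightarrow> real"
    by (induction k) simp_all
  have "(\<Sum>i=1..j. g (Suc i) / 2 ^ (2 * Suc i)) = (\<Sum>i=1..j. g (Suc i) / 2 ^ (2 * i)) / 4"
    by (simp add: sum_divide_distrib field_simps)
  then show ?thesis
    unfolding saw_def shift by (simp add: diff_divide_distrib)
qed

text \<open>Cut j + 1 becomes cut j of the shifted vector, scaled by 4, and cut 0 becomes the bound
  2 y - 1 on z'. The range of \<open>g 0\<close> follows from \<open>branch\<close> and
  \<open>0 \<le> g 1\<close>.\<close>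

lemma saw_path_Cons:
  "saw_path (t # u) g z \<longleftrightarrow> branch t (g 0) (g 1) \<and> 2 * g 0 - 1 \<le> z \<and>
     saw_path u (\<lambda>i. g (Suc i)) (4 * (z - g 0 + g 1 / 2))"
proof -
  have shift: "saw (Suc j) (g 0) g - 1 / 2 ^ (2 * Suc j + 2) \<le> z \<longleftrightarrow>
      saw j (g 1) (\<lambda>i. g (Suc i)) - 1 / 2 ^ (2 * j + 2) \<le> 4 * (z - g 0 + g 1 / 2)" for j
  proof -
    have "a - b / 2 + S / 4 - e / 4 \<le> c \<longleftrightarrow> S - e \<le> 4 * (c - a + b / 2)" for a b c e S :: real
      by auto
    from this[of "g 0" "g 1" _ "1 / 2 ^ (2 * j + 2)"] show ?thesis
      by (simp add: saw_Suc)
  qed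
  have "0 \<le> g 0 \<and> g 0 \<le> 1 \<and> saw 0 (g 0) g - 1 / 2 ^ (2 * 0 + 2) \<le> z \<longleftrightarrow>
      2 * g 1 - 1 \<le> 4 * (z - g 0 + g 1 / 2)" if "branch t (g 0) (g 1)" "0 \<le> g 1"
    using that by (auto simp: saw_def branch_def)
  then show ?thesis
    unfolding saw_path_def length_Cons all_le_Suc_conv All_less_Suc2 shift
    by auto
qed

lemma low_iff_saw_path: "low u x z \<longleftrightarrow> (\<exists>g. g 0 = x \<and> saw_path u g z)"
proof (induction u arbitrary: x z)
  case Nil
  show ?case
    by (auto simp: low_base_def saw_path_def saw_def intro!: exI[of _ "\<lambda>_. x"])
next
  case (Cons t u)
  show ?case
  proof
    assume "low (t # u) x z"
    then obtain g z' where "saw_path u g z'" "branch t x (g 0)" "z = x - g 0 / 2 + z' / 4" "2 * x - 1 \<le> z"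
      by (auto simp: Cons.IH)
    then show "\<exists>g. g 0 = x \<and> saw_path (t # u) g z"
      by (intro exI[of _ "case_nat x g"]) (simp add: saw_path_Cons)
  next
    assume "\<exists>g. g 0 = x \<and> saw_path (t # u) g z"
    then obtain g where "g 0 = x" "saw_path (t # u) g z"
      by blast
    then show "low (t # u) x z"
      by (intro tower_ConsI[of _ _ "g 1"]) (auto simp: saw_path_Cons Cons.IH intro!: exI[of _ "\<lambda>i. g (Suc i)"])
  qed
qed

lemma tower_capped_iff_saw_path:
  "tower (capped n) s x z \<longleftrightarrow>
     (\<exists>g. g 0 = x \<and> saw_path (s @ replicate n None) g z \<and> z \<le> saw (length s) x g)"
proof (induction s arbitrary: x z)
  case Nil
  show ?case
    by (auto simp: capped_def low_iff_saw_path saw_def)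
next
  case (Cons t s)
  show ?case
  proof
    assume "tower (capped n) (t # s) x z"
    then obtain g z' where "saw_path (s @ replicate n None) g z'" "z' \<le> saw (length s) (g 0) g"
      "branch t x (g 0)" "z = x - g 0 / 2 + z' / 4" "2 * x - 1 \<le> z"
      by (auto simp: Cons.IH)
    then show "\<exists>g. g 0 = x \<and> saw_path ((t # s) @ replicate n None) g z \<and> z \<le> saw (length (t # s)) x g"
      using saw_Suc[of "length s" "case_nat x g"]
      by (intro exI[of _ "case_nat x g"]) (simp add: saw_path_Cons)
  next
    assume "\<exists>g. g 0 = x \<and> saw_path ((t # s) @ replicate n None) g z \<and> z \<le> saw (length (t # s)) x g"
    then obtain g where "g 0 = x" "saw_path ((t # s) @ replicate n None) g z"
      "z \<le> saw (length (t # s)) x g"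
      by blast
    then show "tower (capped n) (t # s) x z"
      using saw_Suc[of "length s" g]
      by (intro tower_ConsI[of _ _ "g 1"]) (auto simp: saw_path_Cons Cons.IH intro!: exI[of _ "\<lambda>i. g (Suc i)"])
  qed
qed

section \<open>Fixed variables and the two relaxations\<close>

definition pattern_of :: "nat \<Rightarrow> nat set \<Rightarrow> (nat \<Rightarrow> real) \<Rightarrow> bool option list" where
  "pattern_of L I a = map (\<lambda>j. if Suc j \<in> I then Some (a (Suc j) = 1) else None) [0..<L]"

lemma ball_1_iff: "(\<forall>j\<in>{1..n}. P j) \<longleftrightarrow> (\<forall>j<n. P (Suc j))"
  unfolding image_Suc_lessThan[symmetric] by auto

lemma LP_imp_tower:
  assumes "L \<le> L1" "a \<in> I \<rightarrow> {0, 1}" "(x, z) \<in> proj_xz (fix_alpha I a (P_LP L L1))"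
  shows "tower (capped (L1 - L)) (pattern_of L I a) x z \<and> 0 \<le> z"
proof -
  obtain g \<alpha> where P: "(x, z, g, \<alpha>) \<in> P_LP L L1" and \<alpha>: "\<forall>i\<in>I. \<alpha> i = a i"
    using assms(3) by (auto simp: proj_xz_def fix_alpha_def)
  let ?u = "pattern_of L I a @ replicate (L1 - L) None"
  have g0: "g 0 = x" and g: "\<And>j. j \<le> L1 \<Longrightarrow> 0 \<le> g j \<and> g j \<le> 1"
    and A: "\<forall>j\<in>{1..L}. 2 * (g (j - 1) - \<alpha> j) \<le> g j \<and> g j \<le> 2 * g (j - 1) \<and>
         2 * (\<alpha> j - g (j - 1)) \<le> g j \<and> g j \<le> 2 * (1 - g (j - 1))"
    and T: "\<forall>j\<in>{1..L1}. g j \<le> 2 * g (j - 1) \<and> g j \<le> 2 * (1 - g (j - 1))"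
    and low: "\<And>j. j \<le> L1 \<Longrightarrow> saw j x g - 1 / 2 ^ (2 * j + 2) \<le> z"
    and z: "z \<le> saw L x g" "0 \<le> z" "2 * x - 1 \<le> z"
    using P by (auto simp: P_LP_def tightened_sawtooth_def)
  have "branch (?u ! j) (g j) (g (Suc j))" if j: "j < L1" for j
  proof -
    have "g (Suc j) \<le> 2 * g j \<and> g (Suc j) \<le> 2 * (1 - g j)"
      using T[unfolded ball_1_iff] j by simp
    \<comment> \<open>A binary value makes one of the lower bounds on \<open>g (Suc j)\<close> meet
      the upper bound of the same branch.\<close>
    moreover have "g (Suc j) = (if a (Suc j) = 1 then 2 * (1 - g j) else 2 * g j)"
      if "j < L" "Suc j \<in> I"
    proof -
      have "\<alpha> (Suc j) = a (Suc j)" "a (Suc j) = 0 \<or> a (Suc j) = 1"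
        using \<alpha> assms(2) that by auto
      moreover have "2 * (g j - \<alpha> (Suc j)) \<le> g (Suc j) \<and> g (Suc j) \<le> 2 * g j \<and>
          2 * (\<alpha> (Suc j) - g j) \<le> g (Suc j) \<and> g (Suc j) \<le> 2 * (1 - g j)"
        using A[unfolded ball_1_iff] that by simp
      ultimately show ?thesis
        by auto
    qed
    ultimately show ?thesis
      using j by (auto simp: branch_def pattern_of_def nth_append split: if_splits)
  qed
  then have "saw_path ?u g z"
    using assms(1) g0 g low z by (auto simp: saw_path_def pattern_of_def)
  then show ?thesis
    using g0 z by (auto simp: tower_capped_iff_saw_path pattern_of_def)
qed

text \<open>Serves both relaxations: the second condition on \<open>A\<close> is vacuous when every
  variable is decided, which allows \<open>A = {0, 1}\<close>.\<close>

lemma tower_imp_point: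
  assumes "tower (capped (L1 - L)) s x z" "0 \<le> z" "length s = L" "L \<le> L1"
    and A: "{0, 1} \<subseteq> A" "None \<in> set s \<Longrightarrow> A = {0..1}"
  shows "\<exists>g \<alpha>. (x, z, g, \<alpha>) \<in> tightened_sawtooth A L L1 \<and>
    (\<forall>j<L. \<forall>b. s ! j = Some b \<longrightarrow> \<alpha> (Suc j) = of_bool b)"
proof -
  let ?u = "s @ replicate (L1 - L) None"
  obtain g where g0: "g 0 = x" and path: "saw_path ?u g z" and up: "z \<le> saw L x g"
    using assms(1,3) by (auto simp: tower_capped_iff_saw_path)
  have g: "0 \<le> g j" "g j \<le> 1" "saw j x g - 1 / 2 ^ (2 * j + 2) \<le> z" if "j \<le> L1" for j
    using path that assms(3,4) g0 by (auto simp: saw_path_def)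
  have br: "branch (?u ! j) (g j) (g (Suc j))" if "j < L1" for j
    using path that assms(3,4) by (auto simp: saw_path_def)
  \<comment> \<open>\<open>\<beta> j\<close> is the variable with index j + 1, so \<open>g j\<close>
    is its predecessor entry; this choice for a free variable makes both lower bounds on
    \<open>g (Suc j)\<close> equal to 0.\<close>
  define \<beta> where "\<beta> j = (case s ! j of None \<Rightarrow> g j | Some b \<Rightarrow> of_bool b)" for j
  have \<beta>: "\<beta> j \<in> A" if "j < L" for j
  proof (cases "s ! j")
    case None
    with that assms(3) have "None \<in> set s"
      by (metis nth_mem)
    with A(2) that g[of j] assms(4) None show ?thesis
      by (simp add: \<beta>_def)
  next
    case (Some b)
    with A(1) show ?thesis
      by (cases b) (auto simp: \<beta>_def)
  qed
  have saw_restrict: "saw j x (restrict g {0..L1}) = saw j x g" if "j \<le> L1" for j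
    using that by (auto simp: saw_def intro!: sum.cong)
  have step: "2 * (g j - \<beta> j) \<le> g (Suc j) \<and> 2 * (\<beta> j - g j) \<le> g (Suc j)" if "j < L" for j
    using br[of j] g[of j] g[of "Suc j"] that assms(3,4)
    by (auto simp: branch_def nth_append \<beta>_def split: option.splits bool.splits)
  have tent: "g (Suc j) \<le> 2 * g j \<and> g (Suc j) \<le> 2 * (1 - g j)" if "j < L1" for j
    using br[OF that] by (simp add: branch_def)
  have right: "2 * x - 1 \<le> z"
    using path g0 by (simp add: saw_path_def)
  show ?thesis
  proof (intro exI conjI allI impI)
    show "(x, z, restrict g {0..L1}, restrict (\<lambda>j. \<beta> (j - 1)) {1..L}) \<in> tightened_sawtooth A L L1"
      unfolding tightened_sawtooth_def ball_1_iff mem_Collect_eq prod.case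
    proof (intro conjI ballI allI impI)
      show "x \<in> {0..1}"
        using g0 g[of 0] by simp
      show "restrict g {0..L1} \<in> {0..L1} \<rightarrow>\<^sub>E {0..1}"
        using g by auto
      show "restrict (\<lambda>j. \<beta> (j - 1)) {1..L} \<in> {1..L} \<rightarrow>\<^sub>E A"
        using \<beta> by auto
    qed (use assms(2,4) g0 g(3) tent step up right in \<open>simp_all add: saw_restrict\<close>)
    show "restrict (\<lambda>j. \<beta> (j - 1)) {1..L} (Suc j) = of_bool b" if "j < L" "s ! j = Some b" for j b
      using that by (simp add: \<beta>_def)
  qed
qed

lemma tower_imp_LP:
  assumes "L \<le> L1" "I \<subseteq> {1..L}" "a \<in> I \<rightarrow> {0, 1}"
    and "tower (capped (L1 - L)) (pattern_of L I a) x z" "0 \<le> z"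
  shows "(x, z) \<in> proj_xz (fix_alpha I a (P_LP L L1))"
proof -
  obtain g \<alpha> where P: "(x, z, g, \<alpha>) \<in> P_LP L L1"
    and \<alpha>: "\<And>j b. j < L \<Longrightarrow> pattern_of L I a ! j = Some b \<Longrightarrow> \<alpha> (Suc j) = of_bool b"
    using tower_imp_point[OF assms(4,5) _ assms(1), of "{0..1}"]
    by (auto simp: P_LP_def pattern_of_def)
  have "\<alpha> i = a i" if "i \<in> I" for i
  proof -
    obtain j where j: "i = Suc j" "j < L"
      using assms(2) \<open>i \<in> I\<close> by (cases i) auto
    then have "\<alpha> i = of_bool (a i = 1)"
      using \<alpha>[of j] \<open>i \<in> I\<close> by (simp add: pattern_of_def)
    moreover have "a i = 0 \<or> a i = 1"
      using assms(3) \<open>i \<in> I\<close> by auto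
    ultimately show ?thesis
      by auto
  qed
  with P show ?thesis
    by (force simp: proj_xz_def fix_alpha_def)
qed

lemma ip_region_subset_IP:
  assumes "L \<le> L1" "I \<subseteq> {1..L}" "a \<in> I \<rightarrow> {0, 1}"
  shows "ip_region (pattern_of L I a) (L1 - L) \<subseteq> proj_xz (fix_alpha I a (P_IP L L1))"
proof clarify
  fix x z
  assume "(x, z) \<in> ip_region (pattern_of L I a) (L1 - L)"
  then obtain bs where bs: "0 \<le> z" "tower (capped (L1 - L)) (map Some bs) x z"
      "list_all2 (\<lambda>b t. t = None \<or> t = Some b) bs (pattern_of L I a)"
    by (auto simp: ip_region_def)
  have len: "length bs = L"
    using list_all2_lengthD[OF bs(3)] by (simp add: pattern_of_def)
  obtain g \<alpha> where P: "(x, z, g, \<alpha>) \<in> P_IP L L1"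
    and \<alpha>: "\<And>j. j < L \<Longrightarrow> \<alpha> (Suc j) = of_bool (bs ! j)"
    using tower_imp_point[OF bs(2,1) _ assms(1), of "{0, 1}"] len
    by (auto simp: P_IP_def)
  have "\<alpha> i = a i" if "i \<in> I" for i
  proof -
    obtain j where j: "i = Suc j" "j < L"
      using assms(2) \<open>i \<in> I\<close> by (cases i) auto
    then have "bs ! j = (a i = 1)"
      using list_all2_nthD[OF bs(3), of j] \<open>i \<in> I\<close> len by (simp add: pattern_of_def)
    moreover have "a i = 0 \<or> a i = 1"
      using assms(3) \<open>i \<in> I\<close> by auto
    ultimately show ?thesis
      using \<alpha>[of j] j by auto
  qed
  with P show "(x, z) \<in> proj_xz (fix_alpha I a (P_IP L L1))"
    by (force simp: proj_xz_def fix_alpha_def)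
qed

lemma P_IP_subset_P_LP: "P_IP L L1 \<subseteq> P_LP L L1"
proof -
  have "({1..L} \<rightarrow>\<^sub>E {0, 1}) \<subseteq> ({1..L} \<rightarrow>\<^sub>E {0..1::real})"
    by (rule PiE_mono) auto
  then show ?thesis
    unfolding P_IP_def P_LP_def tightened_sawtooth_def by blast
qed

theorem theorem2:
  fixes L L1 :: nat
  assumes "L \<le> L1"
  shows "hereditarily_sharp L (P_IP L L1) (P_LP L L1)"
  unfolding hereditarily_sharp_def
proof (intro allI impI ballI)
  fix I a
  assume I: "I \<subseteq> {1..L}" and "a \<in> I \<rightarrow>\<^sub>E {0, 1 :: real}"
  then have a: "a \<in> I \<rightarrow> {0, 1}"
    by (simp add: PiE_def)
  let ?LP = "proj_xz (fix_alpha I a (P_LP L L1))" and ?IP = "proj_xz (fix_alpha I a (P_IP L L1))"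
  have LP: "?LP = {(x, z). tower (capped (L1 - L)) (pattern_of L I a) x z \<and> 0 \<le> z}"
    using LP_imp_tower[OF assms a] tower_imp_LP[OF assms I a] by auto
  show "?LP = convex hull ?IP"
  proof
    \<comment> \<open>It suffices that \<open>ip_region\<close> lies inside \<open>?IP\<close>: the
      reverse inclusion of the hulls comes from \<open>?IP \<subseteq> ?LP\<close> and convexity of
      \<open>?LP\<close>.\<close>
    have "?LP \<subseteq> convex hull (ip_region (pattern_of L I a) (L1 - L))"
      unfolding LP using tower_in_hull by blast
    also have "\<dots> \<subseteq> convex hull ?IP"
      by (rule hull_mono[OF ip_region_subset_IP[OF assms I a]])
    finally show "?LP \<subseteq> convex hull ?IP" .
    have "?IP \<subseteq> ?LP"
      unfolding proj_xz_def
      by (rule image_mono) (use P_IP_subset_P_LP in \<open>auto simp: fix_alpha_def\<close>)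
    moreover have "convex ?LP"
      unfolding LP by (rule convex_tower_capped)
    ultimately show "convex hull ?IP \<subseteq> ?LP"
      by (rule hull_minimal)
  qed
qed

end
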